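(* Let $\theta=(\tau,\zeta)\in\Theta$ with $\tau\in\mathrm{T}$, $\zeta\in\mathrm{Z}$, let the prior be $\Pi(\cdot|\lambda)=\tilde\Pi(\cdot|\lambda)\times\tilde\Pi(\cdot)$, where $\tilde\Pi(\cdot|\lambda)$ is a prior for $\tau$ and $\tilde\Pi$ a prior for $\zeta$ not depending on $\lambda\in\Lambda\subseteq\mathbb{R}^\ell$, and let $\theta_0=(\tau_0,\zeta_0)$ be the true parameter value. Let $\hat\lambda_n=\hat\lambda_n(X_{1:n})$ be an estimator, and let $\tilde\Pi(\cdot|\hat\lambda_n)$, $n=1,2,\ldots$, and $\tilde\Pi(\cdot|\lambda_0)$ be probability measures on $\mathcal{B}(\mathrm{T})$. Assume: (A1) there exist constants $c_1,c_2>0$ such that, for any $\epsilon>0$, $P_0^*\bigl(\sup_{\theta\in U_\epsilon^c}R(p_\theta^{(n)})\ge e^{-c_1n\epsilon^2}\bigr)\le c_2(n\epsilon^2)^{-(1+t)}$ for all $n$, for some $t>0$, where $P_0^*$ denotes the outer measure of $P_0^\infty$; (i) $\tilde\Pi(\cdot|\hat\lambda_n)\Rightarrow\tilde\Pi(\cdot|\lambda_0)$ (weak convergence) a.s. $[P_0^\infty]$; (ii) for each $\eta>0$ there exists a set $K_\eta\subseteq B_{\mathrm{KL}}(\theta_0;\eta)$ such that $\Pi(K_\eta|\lambda_0)>0$; (iii) defining, for each $x^\infty\in\mathcal{X}^\infty$ and any $\eta>0$, $$E_{x^\infty}^{(\eta)}:=\Bigl\{(\tau,\zeta)\in K_\eta:\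 \tfrac1n\log\frac{p^{(n)}_{(\tau_0,\zeta_0)}}{p^{(n)}_{(\tau_n,\zeta)}}(x_{1:n})\nrightarrow\mathrm{KL}_\infty\bigl((\tau_0,\zeta_0);(\tau,\zeta)\bigr)\ \text{for some }\tau_n\to\tau\Bigr\},$$ one has $E_{x^\infty}^{(\eta)}\in\mathcal{B}(\mathrm{T})\otimes\mathcal{B}(\mathrm{Z})$ and, for $P_0^\infty$-almost every $x^\infty\in\mathcal{X}^\infty$, $\Pi(E_{x^\infty}^{(\eta)}|\lambda_0)=0$. Then, for any $\epsilon>0$, $$\Pi(U_\epsilon^c|\hat\lambda_n,X_{1:n})\to0\quad\text{a.s. }[P_0^\infty].$$
   Context: $\mathcal{X}$, $\Theta$, $\mathrm{T}$, $\mathrm{Z}$ are complete separable metric spaces with Borel $\sigma$-fields $\mathcal{B}(\cdot)$. $(X_i)_{i\ge1}$ is a sequence of $\mathcal{X}$-valued random elements whose law is modeled by a family $\{P_\theta^\infty:\theta\in\Theta\}$ (not necessarily i.i.d.). $X_{1:n}=(X_1,\ldots,X_n)$, $x_{1:n}=(x_1,\ldots,x_n)$, $x^\infty=(x_1,x_2,\ldots)$. $X_{1:n}$ has law $P_\theta^{(n)}$ with density $p_\theta^{(n)}$ with respect to a common $\sigma$-finite measure (possibly depending on $n$). $P_0^\infty=P_{\theta_0}^\infty$. The likelihood ratio is $R(p_\theta^{(n)})=p_\theta^{(n)}(X_{1:n})/p_{\theta_0}^{(n)}(X_{1:n})$. $d$ is a semi-metric on $\Theta$ and $U_\epsilon=\{\theta\in\Theta:d(\theta,\theta_0)<\epsilon\}$.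 $\mathrm{KL}_\infty(\theta_0;\theta)=-\lim_{n\to\infty}n^{-1}\log R(p_\theta^{(n)})$ (the $P_0^\infty$-a.s. limit, assumed to be a nonrandom number; in the i.i.d. case it is the Kullback–Leibler divergence of $p_\theta$ from $p_{\theta_0}$), and $B_{\mathrm{KL}}(\theta_0;\eta)=\{\theta\in\Theta:\mathrm{KL}_\infty(\theta_0;\theta)<\eta\}$. The estimator $\hat\lambda_n$ takes values in the closure of $\Lambda$; for $\lambda$ in the boundary of $\Lambda$ the prior is defined as the weak limit of the priors at interior values tending to $\lambda$, when it exists. The empirical Bayes posterior is $$\Pi(B|\hat\lambda_n,X_{1:n})=\frac{\int_B p_\theta^{(n)}(X_{1:n})\,\mathrm{d}\Pi(\theta|\hat\lambda_n)}{\int_\Theta p_\theta^{(n)}(X_{1:n})\,\mathrm{d}\Pi(\theta|\hat\lambda_n)},$$ assumed well defined, i.e. a probability measure for all large $n$, $P_\theta^\infty$-a.s., for all $\theta$. The usual measurability (e.g. joint measurability of $(x,\theta)\mapsto p_\theta^{(n)}(x)$, measurability of the sets to which priors are applied) is assumed. *)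

theory Defs
  imports "HOL-Probability.Probability"
begin

text \<open>
  Complete separable metric spaces are types of class \<^class>\<open>polish_space\<close>.  A data sequence
  is a function \<open>x :: nat \<Rightarrow> 'x\<close> with \<open>x i\<close> standing for the observation number \<open>i + 1\<close>, so
  that the first \<open>n\<close> observations are the restriction of \<open>x\<close> to \<open>{..<n}\<close>.  The observations are
  the coordinate maps, so a statement holding almost surely under the law of the sequence is an
  \<open>AE\<close> statement on the product space of all sequences.
\<close>

abbreviation seq_space :: "(nat \<Rightarrow> 'x::polish_space) measure" where
  "seq_space \<equiv> PiM UNIV (\<lambda>_. borel)"

abbreviation sample_space :: "nat \<Rightarrow> (nat \<Rightarrow> 'x::polish_space) measure" where
  "sample_space n \<equiv> PiM {..<n} (\<lambda>_. borel)"

abbreviation first_obs :: "nat \<Rightarrow> (nat \<Rightarrow> 'x) \<Rightarrow> (nat \<Rightarrow> 'x)" where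
  "first_obs n x \<equiv> restrict x {..<n}"

definition semi_metric :: "('a \<Rightarrow> 'a \<Rightarrow> real) \<Rightarrow> bool" where
  "semi_metric d \<longleftrightarrow>
     (\<forall>a b. 0 \<le> d a b) \<and> (\<forall>a. d a a = 0) \<and> (\<forall>a b. d a b = d b a) \<and>
     (\<forall>a b c. d a c \<le> d a b + d b c)"

definition nbhd :: "('a \<Rightarrow> 'a \<Rightarrow> real) \<Rightarrow> 'a \<Rightarrow> real \<Rightarrow> 'a set" where
  "nbhd d \<theta>\<^sub>0 \<epsilon> = {\<theta>. d \<theta> \<theta>\<^sub>0 < \<epsilon>}"


subsection \<open>Likelihood ratios and the Kullback--Leibler rate\<close>

text \<open>The logarithm with \<open>log 0 = - \<infinity>\<close> and \<open>log \<infinity> = \<infinity>\<close>; the function \<^const>\<open>ln\<close> on the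
  reals has \<open>ln 0 = 0\<close>, which would be wrong where a density vanishes.\<close>

definition elog :: "ennreal \<Rightarrow> ereal" where
  "elog r = (if r = 0 then -\<infinity> else if r = \<infinity> then \<infinity> else ereal (ln (enn2real r)))"

text \<open>\<open>p n \<theta>\<close> is the density of the first \<open>n\<close> observations.  Division in \<^typ>\<open>ennreal\<close> gives
  \<open>a / 0 = \<infinity>\<close> for \<open>a > 0\<close>, and \<open>0 / 0 = 0\<close>; when \<open>\<theta>'\<close> is the true parameter, the
  denominator vanishes only on a null set.\<close>

definition lik_ratio ::
  "(nat \<Rightarrow> 'a \<Rightarrow> (nat \<Rightarrow> 'x) \<Rightarrow> real) \<Rightarrow> nat \<Rightarrow> 'a \<Rightarrow> 'a \<Rightarrow> (nat \<Rightarrow> 'x) \<Rightarrow> ennreal" where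
  "lik_ratio p n \<theta> \<theta>' x =
     ennreal (p n \<theta> (first_obs n x)) / ennreal (p n \<theta>' (first_obs n x))"

definition is_log_lik_rate ::
  "(nat \<Rightarrow> 'x) measure \<Rightarrow> (nat \<Rightarrow> 'a \<Rightarrow> (nat \<Rightarrow> 'x) \<Rightarrow> real) \<Rightarrow> 'a \<Rightarrow> 'a \<Rightarrow> ereal \<Rightarrow> bool" where
  "is_log_lik_rate P\<^sub>0 p \<theta>\<^sub>0 \<theta> l \<longleftrightarrow>
     (AE x in P\<^sub>0. (\<lambda>n. ereal (1 / real n) * elog (lik_ratio p n \<theta> \<theta>\<^sub>0 x)) \<longlonglongrightarrow> l)"

definition KL_inf ::
  "(nat \<Rightarrow> 'x) measure \<Rightarrow> (nat \<Rightarrow> 'a \<Rightarrow> (nat \<Rightarrow> 'x) \<Rightarrow> real) \<Rightarrow> 'a \<Rightarrow> 'a \<Rightarrow> ereal" where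
  "KL_inf P\<^sub>0 p \<theta>\<^sub>0 \<theta> = - (THE l. is_log_lik_rate P\<^sub>0 p \<theta>\<^sub>0 \<theta> l)"

definition B_KL ::
  "(nat \<Rightarrow> 'x) measure \<Rightarrow> (nat \<Rightarrow> 'a \<Rightarrow> (nat \<Rightarrow> 'x) \<Rightarrow> real) \<Rightarrow> 'a \<Rightarrow> real \<Rightarrow> 'a set" where
  "B_KL P\<^sub>0 p \<theta>\<^sub>0 \<eta> = {\<theta>. KL_inf P\<^sub>0 p \<theta>\<^sub>0 \<theta> < ereal \<eta>}"

definition bad_set ::
  "(nat \<Rightarrow> 'x) measure \<Rightarrow> (nat \<Rightarrow> 't \<times> 'z \<Rightarrow> (nat \<Rightarrow> 'x) \<Rightarrow> real) \<Rightarrow> 't \<times> 'z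
     \<Rightarrow> ('t::topological_space \<times> 'z) set \<Rightarrow> (nat \<Rightarrow> 'x) \<Rightarrow> ('t \<times> 'z) set" where
  "bad_set P\<^sub>0 p \<theta>\<^sub>0 K x =
     {(\<tau>, \<zeta>) \<in> K. \<exists>\<tau>s. \<tau>s \<longlonglongrightarrow> \<tau> \<and>
        \<not> (\<lambda>n. ereal (1 / real n) * elog (lik_ratio p n \<theta>\<^sub>0 (\<tau>s n, \<zeta>) x))
            \<longlonglongrightarrow> KL_inf P\<^sub>0 p \<theta>\<^sub>0 (\<tau>, \<zeta>)}"


subsection \<open>Priors and the empirical Bayes posterior\<close>

definition weak_limit ::
  "('i \<Rightarrow> 'a::topological_space measure) \<Rightarrow> 'a measure \<Rightarrow> 'i filter \<Rightarrow> bool" where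
  "weak_limit Q M F \<longleftrightarrow>
     (\<forall>f :: 'a \<Rightarrow> real. continuous_on UNIV f \<and> bounded (range f) \<longrightarrow>
        ((\<lambda>i. \<integral>a. f a \<partial>Q i) \<longlongrightarrow> (\<integral>a. f a \<partial>M)) F)"

text \<open>Extension of a family of priors \<open>Q\<close>, given on \<open>\<Lambda>\<close>, to the boundary points of \<open>\<Lambda>\<close> that
  are not in \<open>\<Lambda>\<close>.  Where the weak limit does not exist, the value is unspecified.\<close>

definition ext_prior ::
  "'l::metric_space set \<Rightarrow> ('l \<Rightarrow> 'a::polish_space measure) \<Rightarrow> 'l \<Rightarrow> 'a measure" where
  "ext_prior \<Lambda> Q lam =
     (if lam \<in> \<Lambda> then Q lam
      else (THE M. sets M = sets borel \<and> prob_space M \<and> weak_limit Q M (at lam within \<Lambda>)))"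

text \<open>The set function on the right is a measure even if the normalising integral is
  \<open>0\<close> or \<open>\<infinity>\<close>, see \<open>emeasure_posterior\<close> below; it is a probability measure
  exactly if that integral is positive and finite.\<close>

definition posterior :: "'a measure \<Rightarrow> ('a \<Rightarrow> real) \<Rightarrow> 'a measure" where
  "posterior Q L =
     measure_of (space Q) (sets Q)
       (\<lambda>B. (\<integral>\<^sup>+\<theta>\<in>B. ennreal (L \<theta>) \<partial>Q) / (\<integral>\<^sup>+\<theta>. ennreal (L \<theta>) \<partial>Q))"

lemma space_posterior [simp]: "space (posterior Q L) = space Q"
  and sets_posterior [simp]: "sets (posterior Q L) = sets Q"
  by (simp_all add: posterior_def)

lemma emeasure_posterior:
  assumes [measurable]: "L \<in> borel_measurable Q" and B: "B \<in> sets Q"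
  shows "emeasure (posterior Q L) B =
    (\<integral>\<^sup>+\<theta>\<in>B. ennreal (L \<theta>) \<partial>Q) / (\<integral>\<^sup>+\<theta>. ennreal (L \<theta>) \<partial>Q)"
proof -
  define c where "c = (\<integral>\<^sup>+\<theta>. ennreal (L \<theta>) \<partial>Q)"
  let ?\<mu> = "\<lambda>B. (\<integral>\<^sup>+\<theta>\<in>B. ennreal (L \<theta>) \<partial>Q) / c"
  have eq: "?\<mu> A = emeasure (density Q (\<lambda>\<theta>. ennreal (L \<theta>))) A / c" if "A \<in> sets Q" for A
    using that by (simp add: emeasure_density)
  have "countably_additive (sets Q) ?\<mu>"
  proof (rule countably_additiveI)
    fix A :: "nat \<Rightarrow> 'a set"
    assume A: "range A \<subseteq> sets Q" "disjoint_family A" "\<Union> (range A) \<in> sets Q"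
    have "(\<Sum>i. ?\<mu> (A i)) = (\<Sum>i. emeasure (density Q (\<lambda>\<theta>. ennreal (L \<theta>))) (A i) / c)"
      using A(1) by (intro suminf_cong eq) auto
    also have "\<dots> = (\<Sum>i. emeasure (density Q (\<lambda>\<theta>. ennreal (L \<theta>))) (A i)) / c"
      by simp
    also have "\<dots> = ?\<mu> (\<Union> (range A))"
      using A by (subst suminf_emeasure) (auto simp: eq)
    finally show "(\<Sum>i. ?\<mu> (A i)) = ?\<mu> (\<Union> (range A))" .
  qed
  moreover have "positive (sets Q) ?\<mu>"
    by (simp add: positive_def)
  ultimately show ?thesis
    using B emeasure_measure_of_sigma[OF sets.sigma_algebra_axioms, of Q ?\<mu> B]
    by (simp add: posterior_def c_def)
qed

end

theory Submission
  imports Defs "HOL-Real_Asymp.Real_Asymp"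
begin

text \<open>
  By (A1) and Borel--Cantelli, the likelihood ratio is eventually below \<open>exp (- c\<^sub>1 n \<epsilon>\<^sup>2)\<close>
  on the complement of the neighbourhood, which bounds the numerator of the posterior.  For the
  denominator, take \<open>\<eta> = c\<^sub>1 \<epsilon>\<^sup>2 / 2\<close>: off the bad set, \<open>exp (n \<eta>) R(p\<^sub>n)\<close> is eventually
  at least 1 along every sequence \<open>(\<tau>\<^sub>n, \<zeta>)\<close> with \<open>\<tau>\<^sub>n \<rightarrow> \<tau>\<close>, so a version of Fatou's lemma for
  weakly converging priors keeps its integral above a positive constant.  That version rests on the
  portmanteau inequality for open sets in \<open>\<tau>\<close>, applied for each fixed \<open>\<zeta>\<close>, followed by the
  ordinary Fatou lemma in \<open>\<zeta>\<close>.
\<close>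

text \<open>Portmanteau inequality: the indicator of \<open>G\<close> is the increasing limit of the
  bounded continuous functions \<open>min 1 (k * infdist x (- G))\<close>. For each \<open>k\<close>
  the integrals converge and stay below \<open>emeasure (Q n) G\<close>; monotone convergence in
  \<open>k\<close> finishes.\<close>

lemma weak_limit_open_le_liminf:
  fixes M :: "'a::metric_space measure"
  assumes Q: "\<And>n. prob_space (Q n)" "\<And>n. sets (Q n) = sets borel"
    and M: "prob_space M" "sets M = sets borel"
    and lim: "weak_limit Q M sequentially"
    and "open G"
  shows "emeasure M G \<le> liminf (\<lambda>n. emeasure (Q n) G)"
\<comment> \<open>The whole space is treated by total mass: \<open>infdist x {} = 0\<close> by
  convention, so the approximating functions below would vanish identically.\<close>
proof (cases "G = UNIV")
  case True
  have "emeasure (Q n) UNIV = 1" for n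
    using prob_space.emeasure_space_1[OF Q(1)] sets_eq_imp_space_eq[OF Q(2)] by (metis space_borel)
  moreover have "emeasure M UNIV = 1"
    using prob_space.emeasure_space_1[OF M(1)] sets_eq_imp_space_eq[OF M(2)] by (metis space_borel)
  ultimately show ?thesis
    using True by (simp add: Liminf_const)
next
  case False
  define f :: "nat \<Rightarrow> 'a \<Rightarrow> real" where "f k x = min 1 (real k * infdist x (- G))" for k x
  have f01: "0 \<le> f k x" "f k x \<le> 1" for k x
    by (auto simp: f_def infdist_nonneg)
  have f_out: "f k x = 0" if "x \<notin> G" for k x
    using that by (simp add: f_def)
  have cont: "continuous_on UNIV (f k)" for k
    unfolding f_def by (intro continuous_intros)
  have bdd: "bounded (range (f k))" for k
    unfolding bounded_iff using f01[of k] by (intro exI[of _ 1]) auto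
  have f_meas: "f k \<in> borel_measurable borel" for k
    by (intro borel_measurable_continuous_onI cont)
  have nn: "(\<integral>\<^sup>+x. ennreal (f k x) \<partial>R) = ennreal (\<integral>x. f k x \<partial>R)"
    if "prob_space R" "sets R = sets borel" for R k
  proof (rule nn_integral_eq_integral)
    interpret prob_space R by fact
    have "f k \<in> borel_measurable R"
      using f_meas measurable_cong_sets[OF that(2) refl] by blast
    then show "integrable R (f k)"
      by (rule integrable_const_bound[rotated, of _ 1]) (use f01 in auto)
  qed (use f01 in auto)
  have le: "ennreal (f k x) \<le> indicator G x" for k x
    using f01[of k x] f_out[of x k] by (cases "x \<in> G") auto
  have "incseq (\<lambda>k x. ennreal (f k x))"
    by (intro incseq_SucI le_funI ennreal_leI)
      (unfold f_def, intro min.mono mult_right_mono infdist_nonneg, auto)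
  moreover have "f k \<in> borel_measurable M" for k
    using f_meas measurable_cong_sets[OF M(2) refl] by blast
  ultimately have "(\<integral>\<^sup>+x. (SUP k. ennreal (f k x)) \<partial>M) = (SUP k. \<integral>\<^sup>+x. ennreal (f k x) \<partial>M)"
    by (intro nn_integral_monotone_convergence_SUP) auto
  moreover have "(SUP k. ennreal (f k x)) = indicator G x" for x
  proof (rule antisym)
    show "(SUP k. ennreal (f k x)) \<le> indicator G x"
      by (intro SUP_least le)
    show "indicator G x \<le> (SUP k. ennreal (f k x))"
    proof (cases "x \<in> G")
      case True
      \<comment> \<open>\<open>False\<close> is the outer case \<open>G \<noteq> UNIV\<close>, so
        \<open>- G\<close> is a nonempty closed set missing \<open>x\<close> and has positive
        distance from it.\<close>
      have "0 < infdist x (- G)"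
        using True False \<open>open G\<close> infdist_pos_not_in_closed[of "- G" x] by (auto simp: closed_def)
      then obtain k :: nat where "1 < real k * infdist x (- G)"
        using ex_less_of_nat_mult by blast
      then have "f k x = 1"
        by (simp add: f_def)
      then have "1 \<le> ennreal (f k x)"
        by simp
      then show ?thesis
        using True by (auto intro: SUP_upper2)
    qed auto
  qed
  ultimately have "emeasure M G = (SUP k. \<integral>\<^sup>+x. ennreal (f k x) \<partial>M)"
    using \<open>open G\<close> M(2) by simp
  also have "\<dots> \<le> liminf (\<lambda>n. emeasure (Q n) G)"
  proof (rule SUP_least)
    fix k
    have "(\<lambda>n. \<integral>x. f k x \<partial>Q n) \<longlonglongrightarrow> (\<integral>x. f k x \<partial>M)"
      using lim cont bdd unfolding weak_limit_def by blast
    then have "(\<lambda>n. \<integral>\<^sup>+x. ennreal (f k x) \<partial>Q n) \<longlonglongrightarrow> (\<integral>\<^sup>+x. ennreal (f k x) \<partial>M)"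
      unfolding nn[OF Q] nn[OF M] by (rule tendsto_ennrealI)
    then have "(\<integral>\<^sup>+x. ennreal (f k x) \<partial>M) = liminf (\<lambda>n. \<integral>\<^sup>+x. ennreal (f k x) \<partial>Q n)"
      by (simp add: lim_imp_Liminf)
    also have "\<dots> \<le> liminf (\<lambda>n. \<integral>\<^sup>+x. indicator G x \<partial>Q n)"
      by (intro Liminf_mono always_eventually allI nn_integral_mono le)
    also have "\<dots> = liminf (\<lambda>n. emeasure (Q n) G)"
      using \<open>open G\<close> Q(2) by simp
    finally show "(\<integral>\<^sup>+x. ennreal (f k x) \<partial>M) \<le> liminf (\<lambda>n. emeasure (Q n) G)" .
  qed
  finally show ?thesis .
qed

text \<open>Otherwise \<open>P\<close> fails at arbitrarily late indices arbitrarily close to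
  \<open>a\<close>, and these failures fit into one sequence tending to \<open>a\<close>. This turns
  a condition on sequences into open sets, as the portmanteau inequality requires.\<close>

lemma interior_tail_if_eventually_along_sequences:
  fixes a :: "'a::metric_space"
  assumes ev: "\<And>s. s \<longlonglongrightarrow> a \<Longrightarrow> \<forall>\<^sub>F n in sequentially. P n (s n)"
  shows "\<exists>m. a \<in> interior {y. \<forall>n\<ge>m. P n y}"
proof (rule ccontr)
  assume contr: "\<nexists>m. a \<in> interior {y. \<forall>n\<ge>m. P n y}"
  have ex: "\<exists>n\<ge>m. \<exists>y. dist a y < inverse (real (Suc k)) \<and> \<not> P n y" for m k
  proof -
    have "\<not> ball a (inverse (real (Suc k))) \<subseteq> {y. \<forall>n\<ge>m. P n y}"
      using contr unfolding mem_interior by (metis inverse_Suc)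
    then show ?thesis
      by (auto simp: subset_iff)
  qed
  \<comment> \<open>\<open>F k\<close> pairs an index with a point where \<open>P\<close> fails. The
    indices increase strictly, so each is used at most once.\<close>
  have "\<exists>F. \<forall>k. (dist a (snd (F k)) < inverse (real (Suc k)) \<and> \<not> P (fst (F k)) (snd (F k)))
      \<and> fst (F k) < fst (F (Suc k))"
  proof (rule dependent_nat_choice)
    show "\<exists>x. dist a (snd x) < inverse (real (Suc 0)) \<and> \<not> P (fst x) (snd x)"
      using ex[of 0 0] by auto
    show "\<exists>y. (dist a (snd y) < inverse (real (Suc (Suc k))) \<and> \<not> P (fst y) (snd y)) \<and> fst x < fst y"
      for x :: "nat \<times> 'a" and k
      using ex[of "Suc (fst x)" "Suc k"] by (auto simp: Suc_le_eq)
  qed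
  then obtain F where F: "\<And>k. dist a (snd (F k)) < inverse (real (Suc k))"
      "\<And>k. \<not> P (fst (F k)) (snd (F k))" "\<And>k. fst (F k) < fst (F (Suc k))"
    by blast
  define N where "N = fst \<circ> F"
  have N: "strict_mono N"
    by (auto simp: strict_mono_Suc_iff N_def F)
  \<comment> \<open>The gaps between the chosen indices are filled with \<open>a\<close> itself, so
    only the chosen points matter for convergence.\<close>
  define s where "s n = (if n \<in> range N then snd (F (inv N n)) else a)" for n
  have sN: "s (N k) = snd (F k)" for k
    using strict_mono_imp_inj_on[OF N] by (simp add: s_def)
  have "s \<longlonglongrightarrow> a"
  proof (rule metric_LIMSEQ_I)
    fix r :: real assume "0 < r"
    then obtain k0 where k0: "inverse (real (Suc k0)) < r"
      using reals_Archimedean by blast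
    have "dist (s n) a < r" if "N k0 \<le> n" for n
    proof (cases "n \<in> range N")
      case True
      then obtain k where k: "n = N k" by blast
      then have "k0 \<le> k"
        using that strict_mono_less_eq[OF N] by simp
      then have "inverse (real (Suc k)) \<le> inverse (real (Suc k0))"
        by simp
      then show ?thesis
        using F(1)[of k] k0 unfolding k sN dist_commute[of _ a] by linarith
    qed (use \<open>0 < r\<close> in \<open>simp add: s_def\<close>)
    then show "\<exists>n0. \<forall>n\<ge>n0. dist (s n) a < r"
      by blast
  qed
  from ev[OF this] obtain m where m: "\<And>n. n \<ge> m \<Longrightarrow> P n (s n)"
    by (auto simp: eventually_sequentially)
  have "m \<le> N m"
    by (rule strict_mono_imp_increasing[OF N])
  with m have "P (N m) (s (N m))" .
  with F(2)[of m] show False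
    by (simp add: sN) (simp add: N_def)
qed

text \<open>Only the first factor varies with \<open>n\<close>. Tonelli puts the fixed measure
  \<open>N\<close> outside, where the ordinary Fatou lemma applies; inside, for fixed
  \<open>b\<close>, the portmanteau inequality replaces it.\<close>

lemma fatou_weak_limit_pair:
  fixes M :: "'a::polish_space measure" and N :: "'b::topological_space measure"
    and f :: "nat \<Rightarrow> 'a \<times> 'b \<Rightarrow> ennreal"
  assumes Q: "\<And>n. prob_space (Q n)" "\<And>n. sets (Q n) = sets borel"
    and M: "prob_space M" "sets M = sets borel"
    and N: "prob_space N" "sets N = sets borel"
    and lim: "weak_limit Q M sequentially"
    and f: "\<And>n. f n \<in> borel_measurable (borel \<Otimes>\<^sub>M borel)"
    and A: "A \<in> sets (borel \<Otimes>\<^sub>M borel)"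
    and ev: "\<And>a b s. (a, b) \<in> A \<Longrightarrow> s \<longlonglongrightarrow> a \<Longrightarrow> \<forall>\<^sub>F n in sequentially. 1 \<le> f n (s n, b)"
  shows "emeasure (M \<Otimes>\<^sub>M N) A \<le> liminf (\<lambda>n. \<integral>\<^sup>+z. f n z \<partial>(Q n \<Otimes>\<^sub>M N))"
proof -
  have pair: "pair_sigma_finite R N" if "prob_space R" for R :: "'a measure"
    using that N(1) by (intro pair_sigma_finite.intro prob_space_imp_sigma_finite)
  have sets_pair: "sets (R \<Otimes>\<^sub>M N) = sets (borel \<Otimes>\<^sub>M borel)" if "sets R = sets borel" for R :: "'a measure"
    using that N(2) by (intro sets_pair_measure_cong)
  have f': "f n \<in> borel_measurable (Q n \<Otimes>\<^sub>M N)" for n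
    using f[of n] measurable_cong_sets[OF sets_pair[OF Q(2)[of n]] refl] by blast
  define \<phi> where "\<phi> n b = (\<integral>\<^sup>+a. f n (a, b) \<partial>Q n)" for n b
  have \<phi>: "\<phi> n \<in> borel_measurable N" for n
  proof -
    interpret pair_sigma_finite "Q n" N by (rule pair[OF Q(1)])
    show ?thesis
      unfolding \<phi>_def using M1.borel_measurable_nn_integral_fst[OF measurable_pair_swap[OF f'[of n]]]
      by (simp add: split_beta)
  qed
  \<comment> \<open>The open sets below need not depend measurably on the second coordinate, so they are used
    only for fixed \<open>b\<close>; both sides of the resulting inequality are measurable in \<open>b\<close>.\<close>
  have slice: "emeasure M ((\<lambda>a. (a, b)) -` A) \<le> liminf (\<lambda>n. \<phi> n b)" for b
  proof -
    \<comment> \<open>The portmanteau inequality takes one open set for all \<open>n\<close>.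
      Freezing the threshold \<open>m\<close> supplies it; \<open>m\<close> tends to infinity only
      after the limit in \<open>n\<close>.\<close>
    define G where "G m = interior {a. \<forall>n\<ge>m. 1 \<le> f n (a, b)}" for m :: nat
    have G_open: "open (G m)" for m
      by (simp add: G_def)
    have "incseq G"
      unfolding G_def by (intro monoI interior_mono) auto
    have le: "emeasure M (G m) \<le> liminf (\<lambda>n. \<phi> n b)" for m
    proof -
      have "emeasure (Q n) (G m) \<le> \<phi> n b" if "m \<le> n" for n
      proof -
        have "emeasure (Q n) (G m) = (\<integral>\<^sup>+a. indicator (G m) a \<partial>Q n)"
          using G_open[of m] Q(2)[of n] by simp
        also have "\<dots> \<le> \<phi> n b"
          unfolding \<phi>_def
        proof (rule nn_integral_mono)
          show "indicator (G m) a \<le> f n (a, b)" for a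
            using interior_subset[of "{a. \<forall>n\<ge>m. 1 \<le> f n (a, b)}"] that
            by (auto simp: G_def indicator_def)
        qed
        finally show ?thesis .
      qed
      then have "liminf (\<lambda>n. emeasure (Q n) (G m)) \<le> liminf (\<lambda>n. \<phi> n b)"
        by (intro Liminf_mono) (auto simp: eventually_sequentially)
      with weak_limit_open_le_liminf[OF Q M lim G_open] show ?thesis
        by (rule order_trans)
    qed
    have "(\<lambda>a. (a, b)) -` A \<subseteq> (\<Union>m. G m)"
      using interior_tail_if_eventually_along_sequences[of _ "\<lambda>n a. 1 \<le> f n (a, b)"] ev
      by (auto simp: G_def)
    then have "emeasure M ((\<lambda>a. (a, b)) -` A) \<le> emeasure M (\<Union>m. G m)"
      using G_open M(2) by (intro emeasure_mono) auto
    also have "\<dots> = (SUP m. emeasure M (G m))"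
      using G_open M(2) \<open>incseq G\<close> by (intro SUP_emeasure_incseq[symmetric]) auto
    also have "\<dots> \<le> liminf (\<lambda>n. \<phi> n b)"
      by (intro SUP_least le)
    finally show ?thesis .
  qed
  interpret MN: pair_sigma_finite M N by (rule pair[OF M(1)])
  have "emeasure (M \<Otimes>\<^sub>M N) A = (\<integral>\<^sup>+b. emeasure M ((\<lambda>a. (a, b)) -` A) \<partial>N)"
    using A sets_pair[OF M(2)] by (intro MN.emeasure_pair_measure_alt2) simp
  also have "\<dots> \<le> (\<integral>\<^sup>+b. liminf (\<lambda>n. \<phi> n b) \<partial>N)"
    by (intro nn_integral_mono slice)
  also have "\<dots> \<le> liminf (\<lambda>n. \<integral>\<^sup>+b. \<phi> n b \<partial>N)"
    by (intro nn_integral_liminf \<phi>)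
  also have "(\<lambda>n. \<integral>\<^sup>+b. \<phi> n b \<partial>N) = (\<lambda>n. \<integral>\<^sup>+z. f n z \<partial>(Q n \<Otimes>\<^sub>M N))"
    unfolding \<phi>_def using pair_sigma_finite.nn_integral_snd[OF pair[OF Q(1)] f'] by auto
  finally show ?thesis .
qed

text \<open>Each \<open>A n\<close> has a measurable hull \<open>E n\<close> of the same outer
  measure, and avoiding \<open>E n\<close> implies avoiding \<open>A n\<close>. This serves events
  given by a supremum over uncountably many parameters, which may fail to be measurable.\<close>

lemma borel_cantelli_outer_measure:
  assumes A: "\<And>n. A n \<subseteq> space M"
    and le: "\<And>n. outer_measure_of M (A n) \<le> ennreal (b n)"
    and b: "\<And>n. 0 \<le> b n" "summable b"
  shows "AE x in M. \<forall>\<^sub>F n in sequentially. x \<notin> A n"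
proof -
  obtain E where E: "\<And>n. E n \<in> sets M" "\<And>n. A n \<subseteq> E n"
      "\<And>n. outer_measure_of M (A n) = emeasure M (E n)"
    using outer_measure_of_attain[OF A] by metis
  have fin: "emeasure M (E n) \<le> ennreal (b n)" for n
    using le E(3) by metis
  have "summable (\<lambda>n. measure M (E n))"
  proof (rule summable_comparison_test'[OF b(2)])
    show "norm (measure M (E n)) \<le> b n" for n
      using enn2real_mono[OF fin[of n]] b(1)[of n] by (simp add: measure_def)
  qed
  \<comment> \<open>\<open>measure\<close> is 0 on sets of infinite mass, so the summability above
    carries information only together with finiteness.\<close>
  moreover have "emeasure M (E n) < \<infinity>" for n
    using fin[of n] by (simp add: le_less_trans)
  ultimately have "AE x in M. \<forall>\<^sub>F n in sequentially. x \<in> space M - E n"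
    using E(1) by (intro borel_cantelli_AE1)
  then show ?thesis
    using E(2) by (auto elim!: eventually_mono)
qed

text \<open>The log ratio, with \<open>\<theta>'\<close> in the numerator, is solved for the density
  at \<open>\<theta>\<close>. A vanishing density there would make the ratio infinite, which the
  bound excludes; \<open>n \<ge> 1\<close> keeps the factor \<open>1 / real n\<close> positive, as
  \<open>1 / 0 = 0\<close>.\<close>

lemma lik_ratio_lower_bound:
  assumes "n \<ge> 1" and p0: "0 < p n \<theta>' (first_obs n x)" and p1: "0 \<le> p n \<theta> (first_obs n x)"
    and less: "ereal (1 / real n) * elog (lik_ratio p n \<theta>' \<theta> x) < ereal \<eta>"
  shows "1 \<le> exp (real n * \<eta>) * (p n \<theta> (first_obs n x) / p n \<theta>' (first_obs n x))"
proof -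
  let ?a = "p n \<theta>' (first_obs n x)" and ?b = "p n \<theta> (first_obs n x)"
  have b: "0 < ?b"
  proof (rule ccontr)
    assume "\<not> 0 < ?b"
    then have "?b = 0" using p1 by simp
    then have "lik_ratio p n \<theta>' \<theta> x = \<infinity>"
      using p0 by (simp add: lik_ratio_def ennreal_divide_zero)
    with less \<open>n \<ge> 1\<close> show False
      by (simp add: elog_def)
  qed
  have "lik_ratio p n \<theta>' \<theta> x = ennreal (?a / ?b)"
    using p0 b by (simp add: lik_ratio_def divide_ennreal)
  then have "elog (lik_ratio p n \<theta>' \<theta> x) = ereal (ln (?a / ?b))"
    using divide_pos_pos[OF p0 b] by (simp add: elog_def ennreal_eq_0_iff del: zero_less_divide_iff divide_le_0_iff)
  with less \<open>n \<ge> 1\<close> have "ln (?a / ?b) < real n * \<eta>"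
    by (simp add: field_simps)
  then have "?a / ?b < exp (real n * \<eta>)"
    using p0 b by (metis divide_pos_pos exp_less_mono exp_ln)
  then show ?thesis
    using p0 b by (simp add: field_simps)
qed

text \<open>The factor \<open>l\<close> cancels between numerator and denominator. In the
  application \<open>l\<close> is the true density, \<open>a\<close> the bound from (A1),
  \<open>e = exp (n \<eta>)\<close> and \<open>c\<close> the lower bound for the rescaled
  normalising integral, which may be infinite.\<close>

lemma ennreal_quotient_bound:
  fixes D X :: ennreal
  assumes "X \<le> ennreal a * ennreal l" "ennreal c \<le> ennreal (e / l) * D"
    and pos: "0 \<le> a" "0 < l" "0 < c" "0 < e"
  shows "X / D \<le> ennreal (a * e / c)"
proof (cases D)
  case (real r)
  have "ennreal c \<le> ennreal (e / l * r)"
    using assms(2) real pos ennreal_mult[of "e / l" r] by simp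
  then have cr: "c \<le> e / l * r"
    using real pos by (subst (asm) ennreal_le_iff) auto
  then have "0 < r"
    using real pos by (cases "r = 0") auto
  have "X / D \<le> ennreal (a * l) / ennreal r"
    using assms(1) real pos by (auto simp: ennreal_mult intro!: divide_right_mono_ennreal)
  also have "\<dots> = ennreal (a * l / r)"
    using \<open>0 < r\<close> pos by (simp add: divide_ennreal)
  also have "\<dots> \<le> ennreal (a * e / c)"
  proof (rule ennreal_leI)
    have "c * l \<le> e * r"
      using cr pos by (simp add: field_simps)
    then have "a * (c * l) \<le> a * (e * r)"
      using pos by (intro mult_left_mono)
    then show "a * l / r \<le> a * e / c"
      using \<open>0 < r\<close> pos by (simp add: field_simps)
  qed
  finally show ?thesis .
next
  case top
  then show ?thesis by simp
qed

theorem proposition2p3: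
  fixes P :: "'t::polish_space \<times> 'z::polish_space \<Rightarrow> (nat \<Rightarrow> 'x::polish_space) measure"
    and \<mu> :: "nat \<Rightarrow> (nat \<Rightarrow> 'x) measure"
    and p :: "nat \<Rightarrow> 't \<times> 'z \<Rightarrow> (nat \<Rightarrow> 'x) \<Rightarrow> real"
    and d :: "'t \<times> 'z \<Rightarrow> 't \<times> 'z \<Rightarrow> real"
    and \<tau>\<^sub>0 :: 't and \<zeta>\<^sub>0 :: 'z and \<theta>\<^sub>0 :: "'t \<times> 'z"
    and \<Lambda> :: "(real ^ 'l) set"
    and priorT :: "real ^ 'l \<Rightarrow> 't measure"
    and priorZ :: "'z measure"
    and prior :: "real ^ 'l \<Rightarrow> ('t \<times> 'z) measure"
    and lam\<^sub>0 :: "real ^ 'l"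
    and lam_hat :: "nat \<Rightarrow> (nat \<Rightarrow> 'x) \<Rightarrow> real ^ 'l"
    and K :: "real \<Rightarrow> ('t \<times> 'z) set"
  defines "\<theta>\<^sub>0 \<equiv> (\<tau>\<^sub>0, \<zeta>\<^sub>0)"
    and "prior \<equiv> \<lambda>lam. ext_prior \<Lambda> priorT lam \<Otimes>\<^sub>M priorZ"
  \<comment> \<open>the model\<close>
  assumes P: "\<And>\<theta>. prob_space (P \<theta>)" "\<And>\<theta>. sets (P \<theta>) = sets seq_space"
    and \<mu>: "\<And>n. n \<ge> 1 \<Longrightarrow> sigma_finite_measure (\<mu> n)"
           "\<And>n. n \<ge> 1 \<Longrightarrow> sets (\<mu> n) = sets (sample_space n)"
    and p_nonneg: "\<And>n \<theta> y. n \<ge> 1 \<Longrightarrow> y \<in> space (sample_space n) \<Longrightarrow> 0 \<le> p n \<theta> y"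
    and p_meas: "\<And>n. n \<ge> 1 \<Longrightarrow>
           (\<lambda>(y, \<theta>). p n \<theta> y) \<in> borel_measurable (sample_space n \<Otimes>\<^sub>M (borel \<Otimes>\<^sub>M borel))"
    and p_density: "\<And>n \<theta>. n \<ge> 1 \<Longrightarrow>
           distr (P \<theta>) (sample_space n) (first_obs n) = density (\<mu> n) (\<lambda>y. ennreal (p n \<theta> y))"
    and KL_exists: "\<And>\<theta>. \<exists>l. is_log_lik_rate (P \<theta>\<^sub>0) p \<theta>\<^sub>0 \<theta> l"
    and d: "semi_metric d"
    and nbhd_meas: "\<And>\<epsilon>. \<epsilon> > 0 \<Longrightarrow> nbhd d \<theta>\<^sub>0 \<epsilon> \<in> sets (borel \<Otimes>\<^sub>M borel)"
  \<comment> \<open>the priors, the estimator and the empirical Bayes posterior\<close>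
    and priorT: "\<And>lam. lam \<in> \<Lambda> \<Longrightarrow> prob_space (priorT lam) \<and> sets (priorT lam) = sets borel"
    and priorZ: "prob_space priorZ" "sets priorZ = sets borel"
    and lam_hat_meas: "\<And>n. n \<ge> 1 \<Longrightarrow> lam_hat n \<in> borel_measurable (sample_space n)"
    and lam_hat_closure: "\<And>n x. n \<ge> 1 \<Longrightarrow> lam_hat n (first_obs n x) \<in> closure \<Lambda>"
    and lam\<^sub>0: "lam\<^sub>0 \<in> closure \<Lambda>"
    and prior_lam_hat: "\<And>n x. n \<ge> 1 \<Longrightarrow> prob_space (ext_prior \<Lambda> priorT (lam_hat n (first_obs n x)))"
          "\<And>n x. n \<ge> 1 \<Longrightarrow> sets (ext_prior \<Lambda> priorT (lam_hat n (first_obs n x))) = sets borel"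
    and prior_lam\<^sub>0: "prob_space (ext_prior \<Lambda> priorT lam\<^sub>0)" "sets (ext_prior \<Lambda> priorT lam\<^sub>0) = sets borel"
    and well_defined: "\<And>\<theta>. AE x in P \<theta>. \<forall>\<^sub>F n in sequentially.
          prob_space (posterior (prior (lam_hat n (first_obs n x))) (\<lambda>\<theta>'. p n \<theta>' (first_obs n x)))"
  \<comment> \<open>the assumptions of the proposition\<close>
    and A1: "\<exists>c\<^sub>1 > 0. \<exists>c\<^sub>2 > 0. \<forall>\<epsilon> > 0. \<exists>t > 0. \<forall>n \<ge> 1.
          outer_measure_of (P \<theta>\<^sub>0)
            {x \<in> space (P \<theta>\<^sub>0).
               (SUP \<theta> \<in> - nbhd d \<theta>\<^sub>0 \<epsilon>. lik_ratio p n \<theta> \<theta>\<^sub>0 x) \<ge> ennreal (exp (- c\<^sub>1 * real n * \<epsilon>\<^sup>2))}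
          \<le> ennreal (c\<^sub>2 * (real n * \<epsilon>\<^sup>2) powr (- (1 + t)))"
    and i: "AE x in P \<theta>\<^sub>0. weak_limit (\<lambda>n. ext_prior \<Lambda> priorT (lam_hat n (first_obs n x)))
          (ext_prior \<Lambda> priorT lam\<^sub>0) sequentially"
    and ii: "\<And>\<eta>. \<eta> > 0 \<Longrightarrow> K \<eta> \<in> sets (borel \<Otimes>\<^sub>M borel)"
            "\<And>\<eta>. \<eta> > 0 \<Longrightarrow> K \<eta> \<subseteq> B_KL (P \<theta>\<^sub>0) p \<theta>\<^sub>0 \<eta>"
            "\<And>\<eta>. \<eta> > 0 \<Longrightarrow> emeasure (prior lam\<^sub>0) (K \<eta>) > 0"
    and iii: "\<And>\<eta> x. \<eta> > 0 \<Longrightarrow> bad_set (P \<theta>\<^sub>0) p \<theta>\<^sub>0 (K \<eta>) x \<in> sets (borel \<Otimes>\<^sub>M borel)"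
             "\<And>\<eta>. \<eta> > 0 \<Longrightarrow>
                AE x in P \<theta>\<^sub>0. emeasure (prior lam\<^sub>0) (bad_set (P \<theta>\<^sub>0) p \<theta>\<^sub>0 (K \<eta>) x) = 0"
  shows "\<forall>\<epsilon> > 0. AE x in P \<theta>\<^sub>0.
           (\<lambda>n. emeasure
                  (posterior (prior (lam_hat n (first_obs n x))) (\<lambda>\<theta>. p n \<theta> (first_obs n x)))
                  (- nbhd d \<theta>\<^sub>0 \<epsilon>))
             \<longlonglongrightarrow> 0"
proof (intro allI impI)
  fix \<epsilon> :: real
  assume "0 < \<epsilon>"
  obtain c\<^sub>1 c\<^sub>2 t where c: "0 < c\<^sub>1" "0 < c\<^sub>2" "0 < t"
    and A1': "\<And>n. n \<ge> 1 \<Longrightarrow> outer_measure_of (P \<theta>\<^sub>0)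
            {x \<in> space (P \<theta>\<^sub>0).
               (SUP \<theta> \<in> - nbhd d \<theta>\<^sub>0 \<epsilon>. lik_ratio p n \<theta> \<theta>\<^sub>0 x) \<ge> ennreal (exp (- c\<^sub>1 * real n * \<epsilon>\<^sup>2))}
          \<le> ennreal (c\<^sub>2 * (real n * \<epsilon>\<^sup>2) powr (- (1 + t)))"
    using A1 \<open>0 < \<epsilon>\<close> by blast
  \<comment> \<open>Relative to the true density, the numerator decays like
    \<open>exp (- 2 n \<eta>)\<close> and the denominator loses at most
    \<open>exp (- n \<eta>)\<close> up to a constant, so half the exponent survives in the
    quotient.\<close>
  define \<eta> where "\<eta> = c\<^sub>1 * \<epsilon>\<^sup>2 / 2"
  have "0 < \<eta>"
    using c \<open>0 < \<epsilon>\<close> by (simp add: \<eta>_def)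
  define B where "B = - nbhd d \<theta>\<^sub>0 \<epsilon>"
  define M where "M = ext_prior \<Lambda> priorT lam\<^sub>0"
  define S where "S n = {x \<in> space (P \<theta>\<^sub>0).
      (SUP \<theta> \<in> B. lik_ratio p n \<theta> \<theta>\<^sub>0 x) \<ge> ennreal (exp (- c\<^sub>1 * real n * \<epsilon>\<^sup>2))}" for n
  have B: "B \<in> sets (borel \<Otimes>\<^sub>M borel)"
    using sets.compl_sets[OF nbhd_meas[OF \<open>0 < \<epsilon>\<close>]] by (simp add: B_def space_pair_measure Compl_eq_Diff_UNIV)
  have obs: "first_obs n x \<in> space (sample_space n)" for n and x :: "nat \<Rightarrow> 'x"
    by (simp add: space_PiM)
  have p_meas_param: "(\<lambda>\<theta>. p n \<theta> y) \<in> borel_measurable (borel \<Otimes>\<^sub>M borel)"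
    if "n \<ge> 1" "y \<in> space (sample_space n)" for n y
    using measurable_Pair2[OF p_meas[OF that(1)] that(2)] by simp
  have p_meas_obs: "p n \<theta> \<in> borel_measurable (sample_space n)" if "n \<ge> 1" for n \<theta>
    using measurable_Pair1[OF p_meas[OF that], of \<theta>] by (simp add: space_pair_measure)
  \<comment> \<open>From here on index \<open>n\<close> stands for sample size \<open>Suc n\<close>,
    because the model is constrained only for sizes at least 1.\<close>
  have "AE x in P \<theta>\<^sub>0. \<forall>\<^sub>F n in sequentially. x \<notin> S (Suc n)"
  proof (rule borel_cantelli_outer_measure)
    show "S (Suc n) \<subseteq> space (P \<theta>\<^sub>0)" for n
      by (auto simp: S_def)
    show "outer_measure_of (P \<theta>\<^sub>0) (S (Suc n))
        \<le> ennreal (c\<^sub>2 * (real (Suc n) * \<epsilon>\<^sup>2) powr (- (1 + t)))" for n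
      unfolding S_def B_def by (rule A1') simp
    have "summable (\<lambda>n. c\<^sub>2 * \<epsilon>\<^sup>2 powr (- (1 + t)) * real n powr (- (1 + t)))"
      using c by (intro summable_mult) (simp add: summable_real_powr_iff)
    then have "summable (\<lambda>n. c\<^sub>2 * \<epsilon>\<^sup>2 powr (- (1 + t)) * real (Suc n) powr (- (1 + t)))"
      by (subst summable_Suc_iff)
    then show "summable (\<lambda>n. c\<^sub>2 * (real (Suc n) * \<epsilon>\<^sup>2) powr (- (1 + t)))"
      by (simp add: powr_mult mult_ac del: of_nat_Suc)
  qed (use c in auto)
  \<comment> \<open>A law with a density gives no mass to the zeros of that density. Hence almost
    surely every likelihood ratio against the truth has a positive denominator.\<close>
  moreover have "AE x in P \<theta>\<^sub>0. \<forall>n. 0 < p (Suc n) \<theta>\<^sub>0 (first_obs (Suc n) x)"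
  proof (subst AE_all_countable, rule allI)
    fix n :: nat
    have one: "1 \<le> Suc n"
      by simp
    have obs_meas: "first_obs (Suc n) \<in> measurable (P \<theta>\<^sub>0) (sample_space (Suc n))"
      unfolding measurable_cong_sets[OF P(2) refl] by (rule measurable_restrict_subset) simp
    have "p (Suc n) \<theta>\<^sub>0 \<in> borel_measurable (\<mu> (Suc n))"
      using p_meas_obs[of "Suc n" \<theta>\<^sub>0] measurable_cong_sets[OF \<mu>(2)[of "Suc n"] refl] by auto
    then have "AE y in density (\<mu> (Suc n)) (\<lambda>y. ennreal (p (Suc n) \<theta>\<^sub>0 y)). 0 < p (Suc n) \<theta>\<^sub>0 y"
      by (subst AE_density) auto
    then have "AE y in distr (P \<theta>\<^sub>0) (sample_space (Suc n)) (first_obs (Suc n)). 0 < p (Suc n) \<theta>\<^sub>0 y"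
      unfolding p_density[OF one] .
    then show "AE x in P \<theta>\<^sub>0. 0 < p (Suc n) \<theta>\<^sub>0 (first_obs (Suc n) x)"
      by (rule AE_distrD[OF obs_meas])
  qed
  ultimately show "AE x in P \<theta>\<^sub>0.
           (\<lambda>n. emeasure
                  (posterior (prior (lam_hat n (first_obs n x))) (\<lambda>\<theta>. p n \<theta> (first_obs n x)))
                  (- nbhd d \<theta>\<^sub>0 \<epsilon>))
             \<longlonglongrightarrow> 0"
    using i iii(2)[OF \<open>0 < \<eta>\<close>] AE_space
  proof eventually_elim
    case (elim x)
    define Q where "Q n = ext_prior \<Lambda> priorT (lam_hat (Suc n) (first_obs (Suc n) x))" for n
    define L where "L n \<theta> = p (Suc n) \<theta> (first_obs (Suc n) x)" for n \<theta>
    \<comment> \<open>The likelihood ratio inflated by \<open>exp (Suc n * \<eta>)\<close>, with all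
      that does not depend on \<open>\<theta>\<close> in one factor that can leave the
      integral.\<close>
    define f where "f n \<theta> = ennreal (exp (real (Suc n) * \<eta>) / L n \<theta>\<^sub>0) * ennreal (L n \<theta>)" for n \<theta>
    define A where "A = K \<eta> - bad_set (P \<theta>\<^sub>0) p \<theta>\<^sub>0 (K \<eta>) x"
    have Q: "prob_space (Q n)" "sets (Q n) = sets borel" for n
      unfolding Q_def by (intro prior_lam_hat, simp)+
    have L0: "0 < L n \<theta>\<^sub>0" for n
      using elim(2) by (simp add: L_def)
    have L_nonneg: "0 \<le> L n \<theta>" for n \<theta>
      unfolding L_def by (intro p_nonneg obs) simp
    have L_meas: "L n \<in> borel_measurable (borel \<Otimes>\<^sub>M borel)" for n
      unfolding L_def by (intro p_meas_param obs) simp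
    have sets_Q: "sets (Q n \<Otimes>\<^sub>M priorZ) = sets (borel \<Otimes>\<^sub>M borel)" for n
      by (intro sets_pair_measure_cong Q priorZ)
    have L_meas': "L n \<in> borel_measurable (Q n \<Otimes>\<^sub>M priorZ)" for n
      using L_meas measurable_cong_sets[OF sets_Q refl] by blast
    have f_meas: "f n \<in> borel_measurable (borel \<Otimes>\<^sub>M borel)" for n
      unfolding f_def using L_meas by measurable
    have lim: "weak_limit Q M sequentially"
      using elim(3) LIMSEQ_Suc unfolding weak_limit_def Q_def M_def by blast
    have A: "A \<in> sets (borel \<Otimes>\<^sub>M borel)"
      unfolding A_def by (intro sets.Diff ii(1) iii(1) \<open>0 < \<eta>\<close>)
    have ev: "\<forall>\<^sub>F n in sequentially. 1 \<le> f n (s n, \<zeta>)"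
      if "(\<tau>, \<zeta>) \<in> A" "s \<longlonglongrightarrow> \<tau>" for \<tau> \<zeta> s
    proof -
      \<comment> \<open>\<open>bad_set\<close> indexes sequences by sample size, one ahead of
        \<open>s\<close>, so that \<open>s' (Suc n) = s n\<close>.\<close>
      define s' where "s' n = s (n - 1)" for n
      have "s' \<longlonglongrightarrow> \<tau>"
        by (rule LIMSEQ_imp_Suc) (simp add: s'_def that(2))
      then have "(\<lambda>n. ereal (1 / real n) * elog (lik_ratio p n \<theta>\<^sub>0 (s' n, \<zeta>) x))
            \<longlonglongrightarrow> KL_inf (P \<theta>\<^sub>0) p \<theta>\<^sub>0 (\<tau>, \<zeta>)"
        using that(1) by (auto simp: A_def bad_set_def)
      \<comment> \<open>The limit lies strictly below \<open>\<eta>\<close>, so the normalised log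
        ratios eventually do too.\<close>
      moreover have "KL_inf (P \<theta>\<^sub>0) p \<theta>\<^sub>0 (\<tau>, \<zeta>) < ereal \<eta>"
        using that(1) ii(2)[OF \<open>0 < \<eta>\<close>] by (auto simp: A_def B_KL_def)
      ultimately have "\<forall>\<^sub>F n in sequentially.
          ereal (1 / real n) * elog (lik_ratio p n \<theta>\<^sub>0 (s' n, \<zeta>) x) < ereal \<eta>"
        by (rule order_tendstoD(2))
      then have "\<forall>\<^sub>F n in sequentially.
          ereal (1 / real (Suc n)) * elog (lik_ratio p (Suc n) \<theta>\<^sub>0 (s' (Suc n), \<zeta>) x) < ereal \<eta>"
        by (subst eventually_sequentially_Suc)
      then show ?thesis
      proof eventually_elim
        case (elim n)
        have "1 \<le> exp (real (Suc n) * \<eta>) * (L n (s n, \<zeta>) / L n \<theta>\<^sub>0)"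
          using lik_ratio_lower_bound[OF _ _ _ elim] L0[of n] L_nonneg[of n "(s n, \<zeta>)"]
          by (simp add: L_def s'_def)
        then have "1 \<le> ennreal (exp (real (Suc n) * \<eta>) / L n \<theta>\<^sub>0 * L n (s n, \<zeta>))"
          by simp
        also have "\<dots> = f n (s n, \<zeta>)"
          unfolding f_def using L0[of n] L_nonneg by (intro ennreal_mult) auto
        finally show ?case .
      qed
    qed
    have "emeasure (M \<Otimes>\<^sub>M priorZ) A = emeasure (M \<Otimes>\<^sub>M priorZ) (K \<eta>)"
    proof -
      have sets_M: "sets (M \<Otimes>\<^sub>M priorZ) = sets (borel \<Otimes>\<^sub>M borel)"
        unfolding M_def by (intro sets_pair_measure_cong prior_lam\<^sub>0 priorZ)
      show ?thesis
        unfolding A_def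
        using elim(4) ii(1)[OF \<open>0 < \<eta>\<close>] iii(1)[OF \<open>0 < \<eta>\<close>, of x] sets_M
        by (intro emeasure_Diff_null_set null_setsI) (simp_all add: prior_def M_def)
    qed
    then have "0 < emeasure (M \<Otimes>\<^sub>M priorZ) A"
      using ii(3)[OF \<open>0 < \<eta>\<close>] by (simp add: prior_def M_def)
    also have "\<dots> \<le> liminf (\<lambda>n. \<integral>\<^sup>+\<theta>. f n \<theta> \<partial>(Q n \<Otimes>\<^sub>M priorZ))"
      using prior_lam\<^sub>0 unfolding M_def[symmetric]
      by (intro fatou_weak_limit_pair Q priorZ lim f_meas A ev)
    \<comment> \<open>The lower limit may be infinite; a value strictly between 0 and it is finite,
      hence a real constant.\<close>
    finally obtain c where "0 < c" "c < liminf (\<lambda>n. \<integral>\<^sup>+\<theta>. f n \<theta> \<partial>(Q n \<Otimes>\<^sub>M priorZ))"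
      using dense by blast
    then obtain c' where c': "0 < c'" "ennreal c' < liminf (\<lambda>n. \<integral>\<^sup>+\<theta>. f n \<theta> \<partial>(Q n \<Otimes>\<^sub>M priorZ))"
      by (cases c) auto
    have den: "\<forall>\<^sub>F n in sequentially. ennreal c' < (\<integral>\<^sup>+\<theta>. f n \<theta> \<partial>(Q n \<Otimes>\<^sub>M priorZ))"
      using c'(2) by (rule less_LiminfD)
    have bound: "\<forall>\<^sub>F n in sequentially. emeasure (posterior (Q n \<Otimes>\<^sub>M priorZ) (L n)) B
        \<le> ennreal (exp (- \<eta> * real (Suc n)) / c')"
      using den elim(1)
    proof eventually_elim
      case (elim n)
      interpret Qn: pair_prob_space "Q n" priorZ
        by (intro pair_prob_space.intro pair_sigma_finite.intro prob_space_imp_sigma_finite Q priorZ)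
      let ?D = "\<integral>\<^sup>+\<theta>. ennreal (L n \<theta>) \<partial>(Q n \<Otimes>\<^sub>M priorZ)"
      let ?a = "exp (- c\<^sub>1 * real (Suc n) * \<epsilon>\<^sup>2)"
      \<comment> \<open>Off \<open>S\<close> one constant bounds the likelihood ratio at every
        parameter in \<open>B\<close>, and the prior has total mass 1, so the numerator inherits the
        bound.\<close>
      have sup: "(SUP \<theta> \<in> B. lik_ratio p (Suc n) \<theta> \<theta>\<^sub>0 x) < ennreal ?a"
        using elim(2) \<open>x \<in> space (P \<theta>\<^sub>0)\<close> by (auto simp: S_def not_le)
      have "ennreal (L n \<theta>) \<le> ennreal ?a * ennreal (L n \<theta>\<^sub>0)" if "\<theta> \<in> B" for \<theta>
      proof -
        have "lik_ratio p (Suc n) \<theta> \<theta>\<^sub>0 x \<le> ennreal ?a"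
          using SUP_upper[OF that] sup by (meson order.strict_implies_order order_trans)
        then have "L n \<theta> / L n \<theta>\<^sub>0 \<le> ?a"
          using L0[of n] L_nonneg[of n \<theta>]
          by (simp add: lik_ratio_def divide_ennreal L_def[symmetric] del: of_nat_Suc)
        then show ?thesis
          using L0[of n] by (simp add: ennreal_mult[symmetric] field_simps del: of_nat_Suc)
      qed
      then have "(\<integral>\<^sup>+\<theta>\<in>B. ennreal (L n \<theta>) \<partial>(Q n \<Otimes>\<^sub>M priorZ))
          \<le> (\<integral>\<^sup>+\<theta>. ennreal ?a * ennreal (L n \<theta>\<^sub>0) \<partial>(Q n \<Otimes>\<^sub>M priorZ))"
        by (intro nn_integral_mono) (auto simp: indicator_def)
      also have "\<dots> = ennreal ?a * ennreal (L n \<theta>\<^sub>0)"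
        by (simp add: Qn.emeasure_space_1)
      finally have num: "(\<integral>\<^sup>+\<theta>\<in>B. ennreal (L n \<theta>) \<partial>(Q n \<Otimes>\<^sub>M priorZ)) \<le> ennreal ?a * ennreal (L n \<theta>\<^sub>0)" .
      have "(\<integral>\<^sup>+\<theta>. f n \<theta> \<partial>(Q n \<Otimes>\<^sub>M priorZ)) = ennreal (exp (real (Suc n) * \<eta>) / L n \<theta>\<^sub>0) * ?D"
        unfolding f_def using L_meas'[of n] by (intro nn_integral_cmult) measurable
      then have "ennreal c' \<le> ennreal (exp (real (Suc n) * \<eta>) / L n \<theta>\<^sub>0) * ?D"
        using elim(1) by simp
      from ennreal_quotient_bound[OF num this] L0[of n] c'(1)
      have "emeasure (posterior (Q n \<Otimes>\<^sub>M priorZ) (L n)) B \<le> ennreal (?a * exp (real (Suc n) * \<eta>) / c')"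
        using emeasure_posterior[OF L_meas'] B sets_Q by simp
      \<comment> \<open>Here \<open>c\<^sub>1 * \<epsilon>\<^sup>2 = 2 * \<eta>\<close> is
        used.\<close>
      also have "?a * exp (real (Suc n) * \<eta>) = exp (- \<eta> * real (Suc n))"
        unfolding exp_add[symmetric] by (simp add: \<eta>_def field_simps)
      finally show ?case .
    qed
    have "(\<lambda>n. exp (- \<eta> * real (Suc n)) / c') \<longlonglongrightarrow> 0"
      using \<open>0 < \<eta>\<close> c'(1) by real_asymp
    then have "(\<lambda>n. ennreal (exp (- \<eta> * real (Suc n)) / c')) \<longlonglongrightarrow> 0"
      by (metis tendsto_ennrealI ennreal_0)
    with bound have "(\<lambda>n. emeasure (posterior (Q n \<Otimes>\<^sub>M priorZ) (L n)) B) \<longlonglongrightarrow> 0"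
      by (intro tendsto_sandwich[OF _ bound tendsto_const]) auto
    \<comment> \<open>Shifting the index back adds only the term for sample size 0, which does not
      affect the limit.\<close>
    then show ?case
      unfolding Q_def L_def B_def prior_def by (rule LIMSEQ_imp_Suc)
  qed
qed

end
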